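(* Let $K$ be a field of characteristic zero and let $\mathfrak g=\mathfrak{ut}(n,K)$. The number of $\mathrm T(n,K)$-orbits in $\mathfrak g^*$ is finite for $n\leq 5$ and infinite for $n>5$.
   Context: $\mathfrak{ut}(n,K)$ is the Lie algebra of strictly lower triangular $n\times n$ matrices over $K$. $\mathrm T(n,K)$ is the Borel subgroup of $\mathrm{GL}(n,K)$ consisting of invertible lower triangular matrices; its adjoint action (conjugation) preserves $\mathfrak g$, and this defines the dual action of $\mathrm T(n,K)$ on $\mathfrak g^*$. *)

theory Defs
  imports "Jordan_Normal_Form.Determinant" "HOL-Algebra.Group_Action"
begin

definition lower_triangular :: "'a::zero mat \<Rightarrow> bool" where
  "lower_triangular A \<longleftrightarrow> (\<forall>i < dim_row A. \<forall>j < dim_col A. i < j \<longrightarrow> A $$ (i, j) = 0)"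

definition strictly_lower_triangular :: "'a::zero mat \<Rightarrow> bool" where
  "strictly_lower_triangular A \<longleftrightarrow> (\<forall>i < dim_row A. \<forall>j < dim_col A. i \<le> j \<longrightarrow> A $$ (i, j) = 0)"

text \<open>Only the vector space structure of \<open>ut n\<close> enters its dual space and the set of orbits, so the
  Lie bracket is not recorded.\<close>

definition ut :: "nat \<Rightarrow> 'a::field mat set" where
  "ut n = {x \<in> carrier_mat n n. strictly_lower_triangular x}"

text \<open>Functionals are restricted to \<open>ut n\<close> (they are \<^const>\<open>undefined\<close> elsewhere), so that equality
  of functions is equality of functionals on \<open>ut n\<close>.\<close>

definition ut_dual :: "nat \<Rightarrow> ('a::field mat \<Rightarrow> 'a) set" where
  "ut_dual n = {f \<in> extensional (ut n).
     (\<forall>x \<in> ut n. \<forall>y \<in> ut n. f (x + y) = f x + f y) \<and>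
     (\<forall>c. \<forall>x \<in> ut n. f (c \<cdot>\<^sub>m x) = c * f x)}"

definition GL_group :: "'a::field itself \<Rightarrow> nat \<Rightarrow> 'a mat monoid" where
  "GL_group ty n = units_of (ring_mat ty n ())"

definition T_group :: "'a::field itself \<Rightarrow> nat \<Rightarrow> 'a mat monoid" where
  "T_group ty n = (GL_group ty n)\<lparr>carrier := {t \<in> carrier (GL_group ty n). lower_triangular t}\<rparr>"

text \<open>The dual of the adjoint action \<open>Ad t x = t x t\<^sup>-\<^sup>1\<close>, that is \<open>(t \<cdot> f) x = f (Ad t\<^sup>-\<^sup>1 x)\<close>.\<close>

definition coadjoint :: "nat \<Rightarrow> 'a::field mat \<Rightarrow> ('a mat \<Rightarrow> 'a) \<Rightarrow> ('a mat \<Rightarrow> 'a)" where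
  "coadjoint n t = (\<lambda>f \<in> ut_dual n. \<lambda>x \<in> ut n. f (inv\<^bsub>T_group TYPE('a) n\<^esub> t * x * t))"

lemma GL_group_is_group: "group (GL_group TYPE('a::field) n)"
proof -
  interpret semiring "ring_mat TYPE('a) n ()" by (rule semiring_mat)
  show ?thesis unfolding GL_group_def by (rule units_group)
qed

lemma GL_group_simps:
  "mult (GL_group TYPE('a::field) n) = (*)"
  "one (GL_group TYPE('a) n) = 1\<^sub>m n"
  "carrier (GL_group TYPE('a) n) = Units (ring_mat TYPE('a) n ())"
  by (simp_all add: GL_group_def units_of_def ring_mat_simps)

lemma T_group_simps:
  "mult (T_group TYPE('a::field) n) = (*)"
  "one (T_group TYPE('a) n) = 1\<^sub>m n"
  "carrier (T_group TYPE('a) n) = {t \<in> carrier (GL_group TYPE('a) n). lower_triangular t}"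
  by (simp_all add: T_group_def GL_group_simps)

lemma mat_mult_index:
  fixes A B :: "'a::field mat"
  assumes "A \<in> carrier_mat n n" "B \<in> carrier_mat n n" "i < n" "j < n"
  shows "(A * B) $$ (i, j) = (\<Sum>k<n. A $$ (i, k) * B $$ (k, j))"
  using assms by (auto simp: scalar_prod_def atLeast0LessThan intro!: sum.cong)

lemma lower_triangular_mult:
  fixes A B :: "'a::field mat"
  assumes c: "A \<in> carrier_mat n n" "B \<in> carrier_mat n n"
    and l: "lower_triangular A" "lower_triangular B"
  shows "lower_triangular (A * B)"
proof -
  have "(A * B) $$ (i, j) = 0" if ij: "i < n" "j < n" "i < j" for i j
  proof -
    have "A $$ (i, k) * B $$ (k, j) = 0" if "k < n" for k
      using l c ij that unfolding lower_triangular_def by (cases "i < k") auto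
    then show ?thesis unfolding mat_mult_index[OF c ij(1,2)] by (intro sum.neutral) auto
  qed
  then show ?thesis using c unfolding lower_triangular_def by auto
qed

lemma lower_triangular_inverse:
  fixes A B :: "'a::field mat"
  assumes c: "A \<in> carrier_mat n n" "B \<in> carrier_mat n n"
    and l: "lower_triangular A" and AB: "A * B = 1\<^sub>m n"
  shows "lower_triangular B"
proof -
  have "det A * det B = 1" using det_mult[OF c] AB by simp
  then have "det A \<noteq> 0" by auto
  moreover have "det A = prod_list (diag_mat A)"
    by (rule det_lower_triangular[OF _ c(1)]) (use l c in \<open>auto simp: lower_triangular_def\<close>)
  ultimately have d: "A $$ (i, i) \<noteq> 0" if "i < n" for i
    using that c by (auto simp: diag_mat_def prod_list_zero_iff)
  have "B $$ (i, j) = 0" if "i < n" "j < n" "i < j" for i j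
    using that
  proof (induction i rule: less_induct)
    case (less i)
    have z: "A $$ (i, k) * B $$ (k, j) = 0" if "k < n" "k \<noteq> i" for k
    proof (cases "k < i")
      case True
      then show ?thesis using less.IH[of k] less.prems that by auto
    next
      case False
      then show ?thesis using l c less.prems that unfolding lower_triangular_def by auto
    qed
    have "0 = (\<Sum>k<n. A $$ (i, k) * B $$ (k, j))"
      using mat_mult_index[OF c less.prems(1,2)] AB less.prems by simp
    also have "\<dots> = A $$ (i, i) * B $$ (i, j)"
      using less.prems z by (subst sum.remove[of _ i]) (auto intro!: sum.neutral simp del: mult_eq_0_iff)
    finally show ?case using d[OF less.prems(1)] by simp
  qed
  then show ?thesis using c unfolding lower_triangular_def by auto
qed

lemma GL_inv:
  assumes "t \<in> carrier (GL_group TYPE('a::field) n)"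
  shows "t \<in> carrier_mat n n" "inv\<^bsub>GL_group TYPE('a) n\<^esub> t \<in> carrier_mat n n"
    "t * inv\<^bsub>GL_group TYPE('a) n\<^esub> t = 1\<^sub>m n" "inv\<^bsub>GL_group TYPE('a) n\<^esub> t * t = 1\<^sub>m n"
proof -
  interpret group "GL_group TYPE('a) n" by (rule GL_group_is_group)
  have sub: "carrier (GL_group TYPE('a) n) \<subseteq> carrier_mat n n"
    by (auto simp: GL_group_simps Units_def ring_mat_simps)
  show "t \<in> carrier_mat n n" "inv\<^bsub>GL_group TYPE('a) n\<^esub> t \<in> carrier_mat n n"
    using sub assms inv_closed by auto
  show "t * inv\<^bsub>GL_group TYPE('a) n\<^esub> t = 1\<^sub>m n" "inv\<^bsub>GL_group TYPE('a) n\<^esub> t * t = 1\<^sub>m n"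
    using r_inv[OF assms] l_inv[OF assms] by (simp_all add: GL_group_simps)
qed

lemma T_subgroup:
  "subgroup {t \<in> carrier (GL_group TYPE('a::field) n). lower_triangular t} (GL_group TYPE('a) n)"
proof -
  interpret group "GL_group TYPE('a) n" by (rule GL_group_is_group)
  show ?thesis
  proof (rule subgroup.intro)
    fix x y assume "x \<in> {t \<in> carrier (GL_group TYPE('a) n). lower_triangular t}"
      "y \<in> {t \<in> carrier (GL_group TYPE('a) n). lower_triangular t}"
    then show "x \<otimes>\<^bsub>GL_group TYPE('a) n\<^esub> y \<in> {t \<in> carrier (GL_group TYPE('a) n). lower_triangular t}"
      using lower_triangular_mult[of x n y] m_closed[of x y] GL_inv(1)[of x n] GL_inv(1)[of y n]
      by (auto simp: GL_group_simps(1))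
  next
    show "\<one>\<^bsub>GL_group TYPE('a) n\<^esub> \<in> {t \<in> carrier (GL_group TYPE('a) n). lower_triangular t}"
      using one_closed by (auto simp: GL_group_simps(2) lower_triangular_def)
  next
    fix x assume "x \<in> {t \<in> carrier (GL_group TYPE('a) n). lower_triangular t}"
    then show "inv\<^bsub>GL_group TYPE('a) n\<^esub> x \<in> {t \<in> carrier (GL_group TYPE('a) n). lower_triangular t}"
      using GL_inv[of x n] lower_triangular_inverse[of x n "inv\<^bsub>GL_group TYPE('a) n\<^esub> x"] inv_closed
      by auto
  qed auto
qed

lemma T_group_is_group: "group (T_group TYPE('a::field) n)"
proof -
  interpret group "GL_group TYPE('a) n" by (rule GL_group_is_group)
  show ?thesis unfolding T_group_def by (rule subgroup.subgroup_is_group[OF T_subgroup is_group])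
qed

lemma T_inv:
  assumes "t \<in> carrier (T_group TYPE('a::field) n)"
  shows "t \<in> carrier_mat n n" "inv\<^bsub>T_group TYPE('a) n\<^esub> t \<in> carrier_mat n n"
    "lower_triangular t" "lower_triangular (inv\<^bsub>T_group TYPE('a) n\<^esub> t)"
    "t * inv\<^bsub>T_group TYPE('a) n\<^esub> t = 1\<^sub>m n" "inv\<^bsub>T_group TYPE('a) n\<^esub> t * t = 1\<^sub>m n"
proof -
  interpret group "T_group TYPE('a) n" by (rule T_group_is_group)
  show "t \<in> carrier_mat n n" "inv\<^bsub>T_group TYPE('a) n\<^esub> t \<in> carrier_mat n n"
    "lower_triangular t" "lower_triangular (inv\<^bsub>T_group TYPE('a) n\<^esub> t)"
    using assms inv_closed[OF assms] GL_inv(1) by (auto simp: T_group_simps(3))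
  show "t * inv\<^bsub>T_group TYPE('a) n\<^esub> t = 1\<^sub>m n" "inv\<^bsub>T_group TYPE('a) n\<^esub> t * t = 1\<^sub>m n"
    using r_inv[OF assms] l_inv[OF assms] by (simp_all add: T_group_simps(1,2))
qed

lemma ut_mult:
  fixes t x :: "'a::field mat"
  assumes t: "t \<in> carrier_mat n n" "lower_triangular t" and x: "x \<in> ut n"
  shows "t * x \<in> ut n" "x * t \<in> ut n"
proof -
  have c: "x \<in> carrier_mat n n" and s: "strictly_lower_triangular x" using x by (auto simp: ut_def)
  have "(t * x) $$ (i, j) = 0 \<and> (x * t) $$ (i, j) = 0" if ij: "i < n" "j < n" "i \<le> j" for i j
  proof -
    have l: "t $$ (a, b) = 0" if "a < n" "b < n" "a < b" for a b
      using t that by (simp add: lower_triangular_def)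
    have z: "x $$ (a, b) = 0" if "a < n" "b < n" "a \<le> b" for a b
      using s c that by (simp add: strictly_lower_triangular_def)
    have "t $$ (i, k) * x $$ (k, j) = 0" if "k < n" for k
      using l[OF ij(1) that] z[OF that ij(2)] ij by (cases "i < k") simp_all
    moreover have "x $$ (i, k) * t $$ (k, j) = 0" if "k < n" for k
      using z[OF ij(1) that] l[OF that ij(2)] ij by (cases "i \<le> k") simp_all
    ultimately show ?thesis
      unfolding mat_mult_index[OF t(1) c ij(1,2)] mat_mult_index[OF c t(1) ij(1,2)]
      by (simp add: sum.neutral)
  qed
  then show "t * x \<in> ut n" "x * t \<in> ut n"
    using c t unfolding ut_def strictly_lower_triangular_def by auto
qed

lemma ut_add: "x \<in> ut n \<Longrightarrow> y \<in> ut n \<Longrightarrow> x + y \<in> ut n"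
  and ut_smult: "x \<in> ut n \<Longrightarrow> c \<cdot>\<^sub>m x \<in> ut n"
  by (auto simp: ut_def strictly_lower_triangular_def)

lemma coadjoint_apply:
  assumes "f \<in> ut_dual n" "x \<in> ut n"
  shows "coadjoint n t f x = f (inv\<^bsub>T_group TYPE('a::field) n\<^esub> t * x * (t :: 'a mat))"
  using assms by (simp add: coadjoint_def)

lemma coadjoint_closed:
  fixes t :: "'a::field mat"
  assumes t: "t \<in> carrier (T_group TYPE('a) n)" and f: "f \<in> ut_dual n"
  shows "coadjoint n t f \<in> ut_dual n"
proof -
  let ?s = "inv\<^bsub>T_group TYPE('a) n\<^esub> t"
  note T = T_inv[OF t]
  have u: "?s * x * t \<in> ut n" if "x \<in> ut n" for x
    using ut_mult(2)[OF T(1,3) ut_mult(1)[OF T(2,4) that]] .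
  have c: "x \<in> carrier_mat n n" if "x \<in> ut n" for x :: "'a mat" using that by (auto simp: ut_def)
  have a: "?s * (x + y) * t = ?s * x * t + ?s * y * t" if "x \<in> ut n" "y \<in> ut n" for x y
    using c[OF that(1)] c[OF that(2)] T(1,2)
    by (simp add: mult_add_distrib_mat[of _ n n _ n] add_mult_distrib_mat[of _ n n _ _ n])
  have m: "?s * (k \<cdot>\<^sub>m x) * t = k \<cdot>\<^sub>m (?s * x * t)" if "x \<in> ut n" for x k
    using c[OF that] T(1,2)
    by (simp add: mult_smult_distrib[of _ n n _ n] mult_smult_assoc_mat[of _ n n _ n])
  show ?thesis
    using f u by (auto simp: ut_dual_def coadjoint_def ut_add ut_smult a m)
qed

lemma coadjoint_mult:
  fixes s t :: "'a::field mat"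
  assumes s: "s \<in> carrier (T_group TYPE('a) n)" and t: "t \<in> carrier (T_group TYPE('a) n)"
    and f: "f \<in> ut_dual n"
  shows "coadjoint n (s * t) f = coadjoint n s (coadjoint n t f)"
proof (rule extensionalityI[of _ "ut n"])
  interpret group "T_group TYPE('a) n" by (rule T_group_is_group)
  have "s * t \<in> carrier (T_group TYPE('a) n)" using m_closed[OF s t] by (simp add: T_group_simps(1))
  then show "coadjoint n (s * t) f \<in> extensional (ut n)"
    using coadjoint_closed[OF _ f] by (auto simp: ut_dual_def)
  show "coadjoint n s (coadjoint n t f) \<in> extensional (ut n)"
    using coadjoint_closed[OF s coadjoint_closed[OF t f]] by (auto simp: ut_dual_def)
  fix x :: "'a mat" assume x: "x \<in> ut n"
  let ?s = "inv\<^bsub>T_group TYPE('a) n\<^esub> s" and ?t = "inv\<^bsub>T_group TYPE('a) n\<^esub> t"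
  note S = T_inv[OF s] and T = T_inv[OF t]
  have c: "x \<in> carrier_mat n n" using x by (auto simp: ut_def)
  have i: "inv\<^bsub>T_group TYPE('a) n\<^esub> (s * t) = ?t * ?s"
    using inv_mult_group[OF s t] by (simp add: T_group_simps(1))
  have "?t * ?s * x * (s * t) = ?t * (?s * x * s) * t"
    using S(1,2) T(1,2) c by (simp add: assoc_mult_mat[of _ n n _ n _ n] mult_carrier_mat[of _ n n _ n])
  moreover have "?s * x * s \<in> ut n" using ut_mult(2)[OF S(1,3) ut_mult(1)[OF S(2,4) x]] .
  ultimately show "coadjoint n (s * t) f x = coadjoint n s (coadjoint n t f) x"
    using x f by (simp add: coadjoint_apply coadjoint_closed[OF t f] i)
qed

lemma coadjoint_one: "f \<in> ut_dual n \<Longrightarrow> coadjoint n (1\<^sub>m n) f = f"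
proof (rule extensionalityI[of _ "ut n"])
  interpret group "T_group TYPE('a) n" by (rule T_group_is_group)
  have o: "1\<^sub>m n \<in> carrier (T_group TYPE('a) n)" "inv\<^bsub>T_group TYPE('a) n\<^esub> (1\<^sub>m n) = 1\<^sub>m n"
    using one_closed inv_one by (simp_all add: T_group_simps(2))
  assume f: "f \<in> ut_dual n"
  then show "f \<in> extensional (ut n)" by (simp add: ut_dual_def)
  show "coadjoint n (1\<^sub>m n) f \<in> extensional (ut n)"
    using coadjoint_closed[OF o(1) f] by (simp add: ut_dual_def)
  fix x :: "'a mat" assume x: "x \<in> ut n"
  then have "x \<in> carrier_mat n n" by (simp add: ut_def)
  then show "coadjoint n (1\<^sub>m n) f x = f x" by (simp add: coadjoint_apply f x o(2))
qed

lemma coadjoint_group_action: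
  "group_action (T_group TYPE('a::field) n) (ut_dual n) (coadjoint n)"
proof -
  interpret group "T_group TYPE('a) n" by (rule T_group_is_group)
  let ?T = "T_group TYPE('a) n" and ?E = "ut_dual n :: ('a mat \<Rightarrow> 'a) set"
  have b: "coadjoint n t \<in> Bij ?E" if t: "t \<in> carrier ?T" for t
  proof -
    have "coadjoint n t (coadjoint n (inv\<^bsub>?T\<^esub> t) f) = f"
      "coadjoint n (inv\<^bsub>?T\<^esub> t) (coadjoint n t f) = f" if "f \<in> ?E" for f
      using coadjoint_mult[OF t inv_closed[OF t] that] coadjoint_mult[OF inv_closed[OF t] t that]
        T_inv(5,6)[OF t] coadjoint_one[OF that] by simp_all
    then have "bij_betw (coadjoint n t) ?E ?E"
      by (intro bij_betw_byWitness[where f' = "coadjoint n (inv\<^bsub>?T\<^esub> t)"])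
        (auto simp: coadjoint_closed t)
    then show ?thesis by (auto simp: Bij_def coadjoint_def)
  qed
  have "coadjoint n \<in> hom ?T (BijGroup ?E)"
  proof (rule homI)
    fix s t assume s: "s \<in> carrier ?T" and t: "t \<in> carrier ?T"
    then have "s * t \<in> carrier ?T" using m_closed[of s t] by (simp add: T_group_simps(1))
    show "coadjoint n (s \<otimes>\<^bsub>?T\<^esub> t) = coadjoint n s \<otimes>\<^bsub>BijGroup ?E\<^esub> coadjoint n t"
    proof (rule extensionalityI[of _ ?E])
      show "coadjoint n (s \<otimes>\<^bsub>?T\<^esub> t) \<in> extensional ?E" by (simp add: coadjoint_def)
      show "coadjoint n s \<otimes>\<^bsub>BijGroup ?E\<^esub> coadjoint n t \<in> extensional ?E"
        using b[OF s] b[OF t] by (simp add: BijGroup_def)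
      fix f assume "f \<in> ?E"
      then show "coadjoint n (s \<otimes>\<^bsub>?T\<^esub> t) f = (coadjoint n s \<otimes>\<^bsub>BijGroup ?E\<^esub> coadjoint n t) f"
        using b[OF s] b[OF t] coadjoint_mult[OF s t]
        by (simp add: BijGroup_def compose_def T_group_simps(1))
    qed
  qed (use b in \<open>simp add: BijGroup_def\<close>)
  then show ?thesis
    by (intro group_action.intro group_hom.intro group_hom_axioms.intro is_group group_BijGroup)
qed

end

theory Submission
  imports Defs
begin

text \<open>The trace form identifies the dual of \<open>ut n\<close> with matrices \<open>Y\<close> read only strictly above the diagonal,
  and \<open>t\<close> carries \<open>Y\<close> to \<open>Z\<close> iff \<open>t Y - Z t\<close> is lower triangular. So a multiple of a row may be
  added to a lower row, subtracting at the same time the column of the latter from that of the former,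
  and the torus scales the entries.

  For \<open>n \<le> 5\<close>, use the topmost nonzero entry of the last column to clear its row and column, and
  continue with what is left. In every case the surviving entries form a forest on the index set,
  so the torus scales them to 1: every orbit contains a matrix with entries 0 and 1.

  For \<open>n \<ge> 6\<close>, put \<open>Y\<^sub>0\<^sub>2 = Y\<^sub>1\<^sub>3 = Y\<^sub>1\<^sub>4 = Y\<^sub>2\<^sub>3 = Y\<^sub>3\<^sub>5 = 1\<close> and \<open>Y\<^sub>2\<^sub>4 = c\<close> (counting from 0). Six of the equations for
  \<open>t\<close> force \<open>t\<^sub>1\<^sub>1 = t\<^sub>2\<^sub>2 = t\<^sub>3\<^sub>3 = t\<^sub>4\<^sub>4\<close> and hence show that \<open>c\<close> is an invariant of the orbit.\<close>

section \<open>Functionals in coordinates\<close>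

definition elem_mat :: "nat \<Rightarrow> nat \<Rightarrow> nat \<Rightarrow> 'a::field mat" where
  "elem_mat n a b = mat n n (\<lambda>(i, j). if i = a \<and> j = b then 1 else 0)"

text \<open>The pairing is the trace of \<open>Y * x\<close>. As \<open>Y\<close> is a bare
  function, its values on and below the diagonal are never read and may be arbitrary, so that
  \<open>move\<close> needs no truncation.\<close>

definition dual_of :: "nat \<Rightarrow> (nat \<Rightarrow> nat \<Rightarrow> 'a::field) \<Rightarrow> 'a mat \<Rightarrow> 'a" where
  "dual_of n Y = (\<lambda>x\<in>ut n. \<Sum>a<n. \<Sum>b<a. Y b a * x $$ (a, b))"

lemma ut_carrier: "x \<in> ut n \<Longrightarrow> x \<in> carrier_mat n n"
  by (simp add: ut_def)

lemma elem_mat_ut: "b < a \<Longrightarrow> a < n \<Longrightarrow> elem_mat n a b \<in> ut n"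
  by (auto simp: ut_def elem_mat_def strictly_lower_triangular_def)

lemma dual_of_in_ut_dual: "dual_of n Y \<in> ut_dual n"
proof -
  have "dual_of n Y (x + y) = dual_of n Y x + dual_of n Y y" if "x \<in> ut n" "y \<in> ut n" for x y
    using that ut_carrier[OF that(1)] ut_carrier[OF that(2)]
    by (auto simp: dual_of_def ut_add sum.distrib[symmetric] algebra_simps intro!: sum.cong)
  moreover have "dual_of n Y (c \<cdot>\<^sub>m x) = c * dual_of n Y x" if "x \<in> ut n" for x c
    using that ut_carrier[OF that]
    by (auto simp: dual_of_def ut_smult sum_distrib_left algebra_simps intro!: sum.cong)
  ultimately show ?thesis
    by (simp add: ut_dual_def) (simp add: dual_of_def)
qed

text \<open>Linearity is assumed on \<open>ut n\<close> only, so that this applies also to the maps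
  sending \<open>x\<close> to \<open>f (x * t)\<close> and to \<open>f (t * x)\<close>.\<close>

lemma ut_linear_expand:
  fixes h :: "'a::field mat \<Rightarrow> 'a"
  assumes add: "\<And>x y. x \<in> ut n \<Longrightarrow> y \<in> ut n \<Longrightarrow> h (x + y) = h x + h y"
    and smult: "\<And>c x. x \<in> ut n \<Longrightarrow> h (c \<cdot>\<^sub>m x) = c * h x"
    and x: "x \<in> ut n"
  shows "h x = (\<Sum>a<n. \<Sum>b<a. h (elem_mat n a b) * x $$ (a, b))"
proof -
  define P where "P = (SIGMA a:{..<n}. {..<a})"
  \<comment> \<open>\<open>tr S\<close> keeps the entries of \<open>x\<close> at positions in
    \<open>S\<close>; enlarging \<open>S\<close> by one position adds one multiple of an elementary
    matrix.\<close>
  define tr where "tr S = mat n n (\<lambda>p. if p \<in> S then x $$ p else 0)" for S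
  have z0: "0\<^sub>m n n \<in> ut n" by (auto simp: ut_def strictly_lower_triangular_def)
  have c: "x \<in> carrier_mat n n" using x by (rule ut_carrier)
  have tr_ut: "tr S \<in> ut n" for S
    using x by (auto simp: tr_def ut_def strictly_lower_triangular_def)
  have main: "h (tr S) = (\<Sum>(a, b)\<in>S. h (elem_mat n a b) * x $$ (a, b))" if "finite S" "S \<subseteq> P" for S
    using that
  proof (induction S)
    case empty
    have "tr {} = 0 \<cdot>\<^sub>m 0\<^sub>m n n" by (auto simp: tr_def)
    then show ?case using smult[OF z0, of 0] by simp
  next
    case (insert p S)
    obtain a b where p: "p = (a, b)" by (cases p)
    then have ab: "b < a" "a < n" using insert.prems by (auto simp: P_def)
    have "tr (insert p S) = tr S + x $$ (a, b) \<cdot>\<^sub>m elem_mat n a b"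
      using insert.hyps by (auto simp: tr_def elem_mat_def p)
    then have "h (tr (insert p S)) = h (tr S) + x $$ (a, b) * h (elem_mat n a b)"
      by (simp add: add smult tr_ut ut_smult elem_mat_ut ab)
    then show ?case using insert by (simp add: p)
  qed
  have "tr P = x"
    using x c by (auto simp: tr_def P_def ut_def strictly_lower_triangular_def)
  then show ?thesis
    using main[of P] by (simp add: P_def sum.Sigma)
qed

lemma ut_dual_eq_dual_of:
  assumes f: "f \<in> ut_dual n"
  shows "f = dual_of n (\<lambda>i j. f (elem_mat n j i))"
proof (rule extensionalityI[of _ "ut n"])
  show "f \<in> extensional (ut n)" using f by (simp add: ut_dual_def)
  show "dual_of n (\<lambda>i j. f (elem_mat n j i)) \<in> extensional (ut n)" by (simp add: dual_of_def)
  show "f x = dual_of n (\<lambda>i j. f (elem_mat n j i)) x" if x: "x \<in> ut n" for x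
    using f x ut_linear_expand[of n f x] by (simp add: ut_dual_def dual_of_def)
qed

lemma dual_of_cong:
  assumes "\<And>i j. i < j \<Longrightarrow> j < n \<Longrightarrow> Y i j = Z i j"
  shows "dual_of n Y = dual_of n Z"
  using assms by (auto simp: dual_of_def intro!: sum.cong)

text \<open>Replacing \<open>x\<close> by \<open>t * x\<close>, a bijection of \<open>ut n\<close>,
  removes the inverse and leaves a condition linear in \<open>t\<close>.\<close>

lemma coadjoint_eq_iff:
  fixes t :: "'a::field mat"
  assumes t: "t \<in> carrier (T_group TYPE('a) n)" and f: "f \<in> ut_dual n" and g: "g \<in> ut_dual n"
  shows "coadjoint n t f = g \<longleftrightarrow> (\<forall>x\<in>ut n. f (x * t) = g (t * x))"
proof -
  let ?s = "inv\<^bsub>T_group TYPE('a) n\<^esub> t"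
  note T = T_inv[OF t]
  have cx: "coadjoint n t f (t * x) = f (x * t)" if x: "x \<in> ut n" for x
  proof -
    have "?s * (t * x) = x"
      using T ut_carrier[OF x] by (simp flip: assoc_mult_mat[of _ n n _ n _ n])
    then show ?thesis by (simp add: coadjoint_apply f ut_mult(1)[OF T(1,3) x])
  qed
  show ?thesis
  proof
    assume "coadjoint n t f = g"
    then show "\<forall>x\<in>ut n. f (x * t) = g (t * x)" using cx by auto
  next
    assume r: "\<forall>x\<in>ut n. f (x * t) = g (t * x)"
    show "coadjoint n t f = g"
    proof (rule extensionalityI[of _ "ut n"])
      show "coadjoint n t f \<in> extensional (ut n)" "g \<in> extensional (ut n)"
        using coadjoint_closed[OF t f] g by (simp_all add: ut_dual_def)
      fix x :: "'a mat" assume x: "x \<in> ut n"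
      have sx: "?s * x \<in> ut n" using ut_mult(1)[OF T(2,4) x] .
      have "t * (?s * x) = x"
        using T ut_carrier[OF x] by (simp flip: assoc_mult_mat[of _ n n _ n _ n])
      then show "coadjoint n t f x = g x" using cx[OF sx] r sx by simp
    qed
  qed
qed

text \<open>On elementary matrices the criterion compares entries of \<open>t Y\<close> and
  \<open>Z t\<close>. Since \<open>t\<close> is triangular and \<open>i < j\<close>, the sums read
  \<open>Y\<close> and \<open>Z\<close> only above the diagonal.\<close>

lemma coadjoint_dual_of_iff:
  fixes t :: "'a::field mat"
  assumes t: "t \<in> carrier (T_group TYPE('a) n)"
  shows "coadjoint n t (dual_of n Y) = dual_of n Z \<longleftrightarrow>
    (\<forall>i j. i < j \<longrightarrow> j < n \<longrightarrow>
      (\<Sum>k\<le>i. t $$ (i, k) * Y k j) = (\<Sum>k=j..<n. Z i k * t $$ (k, j)))"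
proof -
  note T = T_inv[OF t]
  note ttri = T(3)[unfolded lower_triangular_def]
  note in_dual = dual_of_in_ut_dual[of n, unfolded ut_dual_def, simplified]
  have L: "dual_of n Y (elem_mat n j i * t) = (\<Sum>k\<le>i. t $$ (i, k) * Y k j)" if ij: "i < j" "j < n" for i j
  proof -
    have e: "(elem_mat n j i * t) $$ (a, b) = (if a = j then t $$ (i, b) else 0)" if "a < n" "b < n" for a b
      using that ij T(1) mat_mult_index[of "elem_mat n j i" n t a b]
      by (auto simp: elem_mat_def if_distrib[of "\<lambda>x. x * _"] cong: if_cong)
    have "dual_of n Y (elem_mat n j i * t) = (\<Sum>a<n. \<Sum>b<a. Y b a * (elem_mat n j i * t) $$ (a, b))"
      using ut_mult(2)[OF T(1,3) elem_mat_ut[OF ij]] by (simp add: dual_of_def)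
    also have "\<dots> = (\<Sum>a<n. if a = j then \<Sum>b<j. Y b j * t $$ (i, b) else 0)"
      by (rule sum.cong) (simp_all add: e)
    also have "\<dots> = (\<Sum>b<j. Y b j * t $$ (i, b))" using ij by simp
    also have "\<dots> = (\<Sum>b\<le>i. Y b j * t $$ (i, b))"
      using ij T(1) ttri by (intro sum.mono_neutral_right) auto
    finally show ?thesis by (simp add: mult.commute)
  qed
  have R: "dual_of n Z (t * elem_mat n j i) = (\<Sum>k=j..<n. Z i k * t $$ (k, j))" if ij: "i < j" "j < n" for i j
  proof -
    have e: "(t * elem_mat n j i) $$ (a, b) = (if b = i then t $$ (a, j) else 0)" if "a < n" "b < n" for a b
      using that ij T(1) mat_mult_index[of t n "elem_mat n j i" a b]
      by (auto simp: elem_mat_def if_distrib[of "\<lambda>x. _ * x"] cong: if_cong)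
    have "dual_of n Z (t * elem_mat n j i) = (\<Sum>a<n. \<Sum>b<a. Z b a * (t * elem_mat n j i) $$ (a, b))"
      using ut_mult(1)[OF T(1,3) elem_mat_ut[OF ij]] by (simp add: dual_of_def)
    also have "\<dots> = (\<Sum>a<n. \<Sum>b<a. if b = i then Z i a * t $$ (a, j) else 0)"
      by (intro sum.cong refl) (simp add: e)
    also have "\<dots> = (\<Sum>a<n. if i < a then Z i a * t $$ (a, j) else 0)"
      by simp
    also have "\<dots> = (\<Sum>a=j..<n. if i < a then Z i a * t $$ (a, j) else 0)"
      using ij T(1) ttri by (intro sum.mono_neutral_right) auto
    also have "\<dots> = (\<Sum>k=j..<n. Z i k * t $$ (k, j))" using ij by (intro sum.cong) auto
    finally show ?thesis .
  qed
  have "(\<forall>x\<in>ut n. dual_of n Y (x * t) = dual_of n Z (t * x)) \<longleftrightarrow>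
    (\<forall>i j. i < j \<longrightarrow> j < n \<longrightarrow>
      dual_of n Y (elem_mat n j i * t) = dual_of n Z (t * elem_mat n j i))" (is "?A \<longleftrightarrow> ?B")
  proof
    assume B: ?B
    show ?A
    proof
      fix x :: "'a mat" assume x: "x \<in> ut n"
      note m = ut_mult[OF T(1,3)]
      have "dual_of n Y (x * t) = (\<Sum>a<n. \<Sum>b<a. dual_of n Y (elem_mat n a b * t) * x $$ (a, b))"
        using x T(1)
        by (intro ut_linear_expand)
          (simp_all add: add_mult_distrib_mat[of _ n n _ _ n] mult_smult_assoc_mat[of _ n n _ n]
            ut_carrier m in_dual)
      also have "\<dots> = (\<Sum>a<n. \<Sum>b<a. dual_of n Z (t * elem_mat n a b) * x $$ (a, b))"
        using B by (intro sum.cong) auto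
      also have "\<dots> = dual_of n Z (t * x)"
        using x T(1)
        by (intro ut_linear_expand[symmetric])
          (simp_all add: mult_add_distrib_mat[of _ n n _ n] mult_smult_distrib[of _ n n _ n]
            ut_carrier m in_dual)
      finally show "dual_of n Y (x * t) = dual_of n Z (t * x)" .
    qed
  qed (auto intro: elem_mat_ut)
  then show ?thesis
    by (simp add: coadjoint_eq_iff[OF t] dual_of_in_ut_dual L R)
qed

lemma T_groupI:
  fixes t :: "'a::field mat"
  assumes c: "t \<in> carrier_mat n n" and l: "lower_triangular t"
    and d: "\<And>i. i < n \<Longrightarrow> t $$ (i, i) \<noteq> 0"
  shows "t \<in> carrier (T_group TYPE('a) n)"
proof -
  have "det t = prod_list (diag_mat t)"
    by (rule det_lower_triangular[OF _ c]) (use l c in \<open>auto simp: lower_triangular_def\<close>)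
  also have "\<dots> \<noteq> 0" using d c by (auto simp: diag_mat_def prod_list_zero_iff)
  finally have "t \<in> Units (ring_mat TYPE('a) n ())" by (rule det_non_zero_imp_unit[OF c])
  then show ?thesis using l by (simp add: T_group_simps GL_group_simps)
qed

lemma T_group_diag:
  fixes t :: "'a::field mat"
  assumes t: "t \<in> carrier (T_group TYPE('a) n)" and i: "i < n"
  shows "t $$ (i, i) \<noteq> 0"
proof -
  note T = T_inv[OF t]
  have "det t * det (inv\<^bsub>T_group TYPE('a) n\<^esub> t) = 1"
    using det_mult[OF T(1,2)] T(5) by simp
  then have "det t \<noteq> 0" by auto
  moreover have "det t = prod_list (diag_mat t)"
    by (rule det_lower_triangular[OF _ T(1)]) (use T in \<open>auto simp: lower_triangular_def\<close>)
  ultimately show ?thesis using i T(1) by (auto simp: diag_mat_def prod_list_zero_iff)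
qed

section \<open>Normal forms for \<open>n \<le> 5\<close>\<close>

definition coadj_equiv :: "nat \<Rightarrow> (nat \<Rightarrow> nat \<Rightarrow> 'a::field) \<Rightarrow> (nat \<Rightarrow> nat \<Rightarrow> 'a) \<Rightarrow> bool" where
  "coadj_equiv n Y Z \<longleftrightarrow>
    (\<exists>t\<in>carrier (T_group TYPE('a) n). coadjoint n t (dual_of n Y) = dual_of n Z)"

definition normalizable :: "nat \<Rightarrow> (nat \<Rightarrow> nat \<Rightarrow> 'a::field) \<Rightarrow> bool" where
  "normalizable n Y \<longleftrightarrow> (\<exists>Z. coadj_equiv n Y Z \<and> (\<forall>i j. i < j \<longrightarrow> j < n \<longrightarrow> Z i j \<in> {0, 1}))"

text \<open>Conjugation by \<open>1 + c E\<^sub>b\<^sub>a\<close> with \<open>a < b\<close>, acting on strictly upper triangular matrices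
  modulo lower triangular ones.\<close>

definition move :: "nat \<Rightarrow> nat \<Rightarrow> 'a \<Rightarrow> (nat \<Rightarrow> nat \<Rightarrow> 'a::field) \<Rightarrow> nat \<Rightarrow> nat \<Rightarrow> 'a" where
  "move a b c Y i j = Y i j + (if i = b then c * Y a j else 0) - (if j = a then c * Y i b else 0)"

section \<open>Elementary moves and torus scaling\<close>

lemma coadj_equiv_trans:
  fixes X :: "nat \<Rightarrow> nat \<Rightarrow> 'a::field"
  assumes "coadj_equiv n X Y" "coadj_equiv n Y Z"
  shows "coadj_equiv n X Z"
proof -
  interpret group "T_group TYPE('a) n" by (rule T_group_is_group)
  obtain s t where st: "s \<in> carrier (T_group TYPE('a) n)" "t \<in> carrier (T_group TYPE('a) n)"
    "coadjoint n t (dual_of n X) = dual_of n Y" "coadjoint n s (dual_of n Y) = dual_of n Z"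
    using assms by (auto simp: coadj_equiv_def)
  then have "coadjoint n (s * t) (dual_of n X) = dual_of n Z"
    by (simp add: coadjoint_mult dual_of_in_ut_dual)
  moreover have "s * t \<in> carrier (T_group TYPE('a) n)"
    using m_closed[OF st(1,2)] by (simp add: T_group_simps)
  ultimately show ?thesis by (auto simp: coadj_equiv_def)
qed

lemma coadj_equivI:
  fixes t :: "'a::field mat"
  assumes "t \<in> carrier_mat n n" "lower_triangular t" "\<And>i. i < n \<Longrightarrow> t $$ (i, i) \<noteq> 0"
    and "\<And>i j. i < j \<Longrightarrow> j < n \<Longrightarrow>
      (\<Sum>k\<le>i. t $$ (i, k) * Y k j) = (\<Sum>k=j..<n. Z i k * t $$ (k, j))"
  shows "coadj_equiv n Y Z"
proof -
  have t: "t \<in> carrier (T_group TYPE('a) n)" using assms by (intro T_groupI)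
  then show ?thesis using coadjoint_dual_of_iff[OF t, of Y Z] assms(4) by (auto simp: coadj_equiv_def)
qed

lemma coadj_equiv_move:
  fixes Y :: "nat \<Rightarrow> nat \<Rightarrow> 'a::field"
  assumes "a < b" "b < n"
  shows "coadj_equiv n Y (move a b c Y)"
proof (rule coadj_equivI)
  let ?t = "mat n n (\<lambda>(i, j). if i = j then 1 else if i = b \<and> j = a then c else 0)"
  show "?t \<in> carrier_mat n n" "lower_triangular ?t"
    using assms by (auto simp: lower_triangular_def)
  fix i j :: nat assume ij: "i < j" "j < n"
  have "(\<Sum>k\<le>i. ?t $$ (i, k) * Y k j) =
      (\<Sum>k\<le>i. (if k = i then Y i j else 0) + (if k = a then (if i = b then c * Y a j else 0) else 0))"
    using ij assms by (intro sum.cong) auto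
  also have "\<dots> = Y i j + (if i = b then c * Y a j else 0)"
    using assms by (simp add: sum.distrib)
  \<comment> \<open>If \<open>j = a\<close> then \<open>i < a < b\<close>, so the move leaves entry
    \<open>(i, b)\<close> unchanged and \<open>Y i b\<close> may be replaced by its new
    value.\<close>
  also have "\<dots> = move a b c Y i j + (if j = a then move a b c Y i b * c else 0)"
    using ij assms by (auto simp: move_def)
  also have "\<dots> = (\<Sum>k=j..<n. (if k = j then move a b c Y i j else 0) +
      (if k = b then (if j = a then move a b c Y i b * c else 0) else 0))"
    using ij assms by (simp add: sum.distrib)
  also have "\<dots> = (\<Sum>k=j..<n. move a b c Y i k * ?t $$ (k, j))"
    using ij assms by (intro sum.cong) auto
  finally show "(\<Sum>k\<le>i. ?t $$ (i, k) * Y k j) = (\<Sum>k=j..<n. move a b c Y i k * ?t $$ (k, j))" .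
qed auto

lemma coadj_equiv_scale:
  fixes Y :: "nat \<Rightarrow> nat \<Rightarrow> 'a::field"
  assumes d: "\<And>i. d i \<noteq> 0"
  shows "coadj_equiv n Y (\<lambda>i j. d i * Y i j / d j)"
proof (rule coadj_equivI)
  let ?t = "mat n n (\<lambda>(i, j). if i = j then d i else 0)"
  show "?t \<in> carrier_mat n n" "lower_triangular ?t" by (auto simp: lower_triangular_def)
  show "?t $$ (i, i) \<noteq> 0" if "i < n" for i using that d by simp
  fix i j :: nat assume ij: "i < j" "j < n"
  have "(\<Sum>k\<le>i. ?t $$ (i, k) * Y k j) = (\<Sum>k\<le>i. if k = i then d i * Y i j else 0)"
    using ij by (intro sum.cong) auto
  also have "\<dots> = (\<Sum>k=j..<n. if k = j then d i * Y i j else 0)" using ij by simp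
  also have "\<dots> = (\<Sum>k=j..<n. d i * Y i k / d k * ?t $$ (k, j))"
    using ij d by (intro sum.cong) auto
  finally show "(\<Sum>k\<le>i. ?t $$ (i, k) * Y k j) = (\<Sum>k=j..<n. d i * Y i k / d k * ?t $$ (k, j))" .
qed

text \<open>Chained by \<open>rule\<close>, this performs moves in the order written; their
  coefficients refer to the initial \<open>Y\<close>, not to the matrix reached so far.\<close>

lemma normalizable_move:
  assumes "normalizable n (move a b c Y)" "a < b" "b < n"
  shows "normalizable n Y"
  using assms unfolding normalizable_def by (meson coadj_equiv_move coadj_equiv_trans)

lemma all_pairs_less_5:
  "(\<forall>i j. i < j \<longrightarrow> j < 5 \<longrightarrow> P i j) \<longleftrightarrow>
    P 0 1 \<and> P 0 2 \<and> P 0 3 \<and> P 0 4 \<and> P 1 2 \<and> P 1 3 \<and> P 1 4 \<and> P 2 3 \<and> P 2 4 \<and> P 3 (4::nat)"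
proof -
  have "(\<forall>i j. i < j \<longrightarrow> j < 5 \<longrightarrow> P i j) \<longleftrightarrow> (\<forall>j<5. \<forall>i<j. P i j)" by blast
  then show ?thesis by (simp add: eval_nat_numeral All_less_Suc conj_ac)
qed

text \<open>A vanishing entry needs no scaling but its factor must be invertible; with
  \<open>nz\<close>, one diagonal matrix serves every pattern of zeros.\<close>

definition nz :: "'a::field \<Rightarrow> 'a" where "nz y = (if y = 0 then 1 else y)"

lemma nz_nonzero [simp]: "nz y \<noteq> 0"
  by (simp add: nz_def)

lemma divide_nz [simp]: "y / nz y = (if y = 0 then 0 else 1)"
  by (simp add: nz_def)

text \<open>Testing all pairs below 5 treats every \<open>n \<le> 5\<close> at once, with matrices
  padded by zero columns.\<close>

lemma normalizable_scale:
  fixes d :: "nat \<Rightarrow> 'a::field"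
  assumes n: "n \<le> 5" and d: "\<And>i. d i \<noteq> 0"
    and z: "\<forall>i j. i < j \<longrightarrow> j < 5 \<longrightarrow> d i * Y i j / d j \<in> {0, 1}"
  shows "normalizable n Y"
  unfolding normalizable_def
proof (intro exI conjI allI impI)
  show "coadj_equiv n Y (\<lambda>i j. d i * Y i j / d j)" by (rule coadj_equiv_scale[OF d])
qed (use z n in simp)

text \<open>When the nonzero entries are the edges \<open>{i, j}\<close> of a forest, suitable \<open>d\<close> are products of
  \<^const>\<open>nz\<close> entries along its paths.\<close>

lemma normalizable_forest:
  assumes n: "n \<le> 5" and d: "d0 \<noteq> 0" "d1 \<noteq> 0" "d2 \<noteq> 0" "d3 \<noteq> 0" "d4 \<noteq> 0"
   and "d0 * Y 0 1 / d1 \<in> {0, 1}" "d0 * Y 0 2 / d2 \<in> {0, 1}" "d0 * Y 0 3 / d3 \<in> {0, 1}"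
     "d0 * Y 0 4 / d4 \<in> {0, 1}" "d1 * Y 1 2 / d2 \<in> {0, 1}" "d1 * Y 1 3 / d3 \<in> {0, 1}"
     "d1 * Y 1 4 / d4 \<in> {0, 1}" "d2 * Y 2 3 / d3 \<in> {0, 1}" "d2 * Y 2 4 / d4 \<in> {0, 1}"
     "d3 * Y 3 4 / d4 \<in> {0, 1}"
  shows "normalizable n Y"
  by (rule normalizable_scale[OF n, where d = "\<lambda>i. if i = 0 then d0 else if i = 1 then d1
    else if i = 2 then d2 else if i = 3 then d3 else d4"], use d in simp, unfold all_pairs_less_5)
   (use assms in simp)

section \<open>Elimination by the position of the pivot\<close>

lemma normalizable_pivot_04:
  fixes Y :: "nat \<Rightarrow> nat \<Rightarrow> 'a::field"
  assumes "Y 0 1 = 0" "Y 0 2 = 0" "Y 0 3 = 0" "Y 1 4 = 0" "Y 2 4 = 0" "Y 3 4 = 0"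
  shows "normalizable 5 Y"
\<comment> \<open>The only possible cycle is the triangle 1, 2, 3; a nonzero entry
  \<open>(1, 3)\<close> clears its other two edges.\<close>
proof (cases "Y 1 3 = 0")
  case True
  show ?thesis
    by (rule normalizable_forest[of _ 1 1 "nz (Y 1 2)" "nz (Y 1 2) * nz (Y 2 3)" "nz (Y 0 4)"])
      (use assms True in simp_all)
next
  case False
  show ?thesis
    by (rule normalizable_move[of _ 2 3 "Y 1 2 / Y 1 3"],
        rule normalizable_move[of _ 1 2 "- Y 2 3 / Y 1 3"],
        rule normalizable_forest[of _ 1 1 1 "nz (Y 1 3)" "nz (Y 0 4)"])
      (use assms False in \<open>simp_all add: move_def\<close>)
qed

lemma normalizable_pivot_14:
  fixes Y :: "nat \<Rightarrow> nat \<Rightarrow> 'a::field"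
  assumes "Y 0 4 = 0" "Y 1 2 = 0" "Y 1 3 = 0" "Y 2 4 = 0" "Y 3 4 = 0"
  shows "normalizable 5 Y"
\<comment> \<open>Likewise for the triangle 0, 2, 3.\<close>
proof (cases "Y 0 3 = 0")
  case True
  show ?thesis
    by (rule normalizable_forest[of _ 1 "nz (Y 0 1)" "nz (Y 0 2)" "nz (Y 0 2) * nz (Y 2 3)"
            "nz (Y 0 1) * nz (Y 1 4)"])
      (use assms True in simp_all)
next
  case False
  show ?thesis
    by (rule normalizable_move[of _ 2 3 "Y 0 2 / Y 0 3"],
        rule normalizable_move[of _ 0 2 "- Y 2 3 / Y 0 3"],
        rule normalizable_forest[of _ 1 "nz (Y 0 1)" 1 "nz (Y 0 3)" "nz (Y 0 1) * nz (Y 1 4)"])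
      (use assms False in \<open>simp_all add: move_def\<close>)
qed

text \<open>The forest is the path 1 - 3 - 0 - 2 - 4. Starting from 1 at vertex 0 would give vertex
  1 a quotient by \<open>nz (Y 1 3)\<close>, so all factors are multiplied by it.\<close>

lemma normalizable_pivot_24_02:
  fixes Y :: "nat \<Rightarrow> nat \<Rightarrow> 'a::field"
  assumes "Y 0 1 = 0" "Y 0 4 = 0" "Y 1 2 = 0" "Y 1 4 = 0" "Y 2 3 = 0" "Y 3 4 = 0"
  shows "normalizable 5 Y"
  by (rule normalizable_forest[of _ "nz (Y 1 3)" "nz (Y 0 3)" "nz (Y 1 3) * nz (Y 0 2)"
          "nz (Y 1 3) * nz (Y 0 3)" "nz (Y 1 3) * nz (Y 0 2) * nz (Y 2 4)"])
    (use assms in \<open>simp_all add: mult.commute\<close>)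

lemma normalizable_pivot_24:
  fixes Y :: "nat \<Rightarrow> nat \<Rightarrow> 'a::field"
  assumes "Y 2 4 \<noteq> 0" "Y 0 4 = 0" "Y 1 4 = 0" "Y 2 3 = 0" "Y 3 4 = 0"
  shows "normalizable 5 Y"
proof -
  consider "Y 0 2 \<noteq> 0" | "Y 0 2 = 0" "Y 0 3 \<noteq> 0" | "Y 0 2 = 0" "Y 0 3 = 0" by blast
  then show ?thesis
  proof cases
    case 1
    \<comment> \<open>\<open>y\<close> is entry \<open>(1, 3)\<close> after the first move. The
      second move spills a multiple of \<open>y\<close> into \<open>(2, 3)\<close>, which the third
      clears by means of \<open>Y 2 4\<close>.\<close>
    define y where "y = Y 1 3 - Y 1 2 / Y 0 2 * Y 0 3"
    show ?thesis
      by (rule normalizable_move[of _ 0 1 "- Y 1 2 / Y 0 2"],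
          rule normalizable_move[of _ 1 2 "Y 0 1 / Y 0 2"],
          rule normalizable_move[of _ 3 4 "Y 0 1 / Y 0 2 * y / Y 2 4"],
          rule normalizable_pivot_24_02)
        (use assms 1 in \<open>simp_all add: move_def y_def field_simps\<close>)
  next
    case 2
    show ?thesis
      by (rule normalizable_move[of _ 1 3 "Y 0 1 / Y 0 3"],
          rule normalizable_move[of _ 0 1 "- Y 1 3 / Y 0 3"],
          rule normalizable_forest[of _ 1 1 "nz (Y 1 2)" "nz (Y 0 3)" "nz (Y 1 2) * nz (Y 2 4)"])
        (use assms 2 in \<open>simp_all add: move_def\<close>)
  next
    case 3
    show ?thesis
      by (rule normalizable_forest[of _ 1 "nz (Y 0 1)" "nz (Y 0 1) * nz (Y 1 2)"
              "nz (Y 0 1) * nz (Y 1 3)" "nz (Y 0 1) * nz (Y 1 2) * nz (Y 2 4)"])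
        (use assms 3 in simp_all)
  qed
qed

lemma normalizable_forest_13:
  fixes Y :: "nat \<Rightarrow> nat \<Rightarrow> 'a::field"
  assumes "n \<le> 5" "Y 0 3 = 0" "Y 0 4 = 0" "Y 1 2 = 0" "Y 1 4 = 0" "Y 2 3 = 0" "Y 2 4 = 0"
  shows "normalizable n Y"
  by (rule normalizable_forest[of _ 1 "nz (Y 0 1)" "nz (Y 0 2)" "nz (Y 0 1) * nz (Y 1 3)"
          "nz (Y 0 1) * nz (Y 1 3) * nz (Y 3 4)"])
    (use assms in simp_all)

lemma normalizable_forest_02:
  fixes Y :: "nat \<Rightarrow> nat \<Rightarrow> 'a::field"
  assumes "n \<le> 5" "Y 0 1 = 0" "Y 0 3 = 0" "Y 0 4 = 0" "Y 1 2 = 0" "Y 1 3 = 0" "Y 1 4 = 0" "Y 2 4 = 0"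
  shows "normalizable n Y"
  by (rule normalizable_forest[of _ 1 1 "nz (Y 0 2)" "nz (Y 0 2) * nz (Y 2 3)"
          "nz (Y 0 2) * nz (Y 2 3) * nz (Y 3 4)"])
    (use assms in simp_all)

text \<open>The rest of column 4 being zero, no move used here changes \<open>(3, 4)\<close>, which
  attaches vertex 4 as a leaf to 3. This leaves elimination on four indices, with the topmost
  nonzero entry of column 3 as pivot, then \<open>(0, 2)\<close>.\<close>

lemma normalizable_last_column_zero:
  fixes Y :: "nat \<Rightarrow> nat \<Rightarrow> 'a::field"
  assumes "n \<le> 5" "\<And>i j. n \<le> j \<Longrightarrow> Y i j = 0" "Y 0 4 = 0" "Y 1 4 = 0" "Y 2 4 = 0"
  shows "normalizable n Y"
proof -
  have less: "j < n" if "Y i j \<noteq> 0" for i j using that assms(2) not_le by blast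
  consider "Y 0 3 \<noteq> 0" | "Y 0 3 = 0" "Y 1 3 \<noteq> 0" | "Y 0 3 = 0" "Y 1 3 = 0" "Y 0 2 \<noteq> 0"
    | "Y 0 3 = 0" "Y 1 3 = 0" "Y 0 2 = 0" by blast
  then show ?thesis
  proof cases
    case 1
    then have "3 < n" by (rule less)
    \<comment> \<open>Clearing \<open>(0, 2)\<close> alters \<open>(1, 2)\<close>, hence the
      corrected entry in the scaling factor of index 2.\<close>
    show ?thesis
      by (rule normalizable_move[of _ 1 3 "Y 0 1 / Y 0 3"],
          rule normalizable_move[of _ 2 3 "Y 0 2 / Y 0 3"],
          rule normalizable_move[of _ 0 1 "- Y 1 3 / Y 0 3"],
          rule normalizable_move[of _ 0 2 "- Y 2 3 / Y 0 3"],
          rule normalizable_forest[of _ 1 1 "nz (Y 1 2 - Y 0 2 * Y 1 3 / Y 0 3)" "nz (Y 0 3)"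
                  "nz (Y 0 3) * nz (Y 3 4)"])
        (use assms 1 \<open>3 < n\<close> in \<open>simp_all add: move_def nz_def\<close>)
  next
    case 2
    then have "3 < n" by (intro less)
    show ?thesis
      by (rule normalizable_move[of _ 1 2 "- Y 2 3 / Y 1 3"],
          rule normalizable_move[of _ 2 3 "Y 1 2 / Y 1 3"],
          rule normalizable_forest_13)
        (use assms 2 \<open>3 < n\<close> in \<open>simp_all add: move_def\<close>)
  next
    case 3
    then have "2 < n" by (intro less)
    show ?thesis
      by (rule normalizable_move[of _ 0 1 "- Y 1 2 / Y 0 2"],
          rule normalizable_move[of _ 1 2 "Y 0 1 / Y 0 2"],
          rule normalizable_forest_02)
        (use assms 3 \<open>2 < n\<close> in \<open>simp_all add: move_def\<close>)
  next
    case 4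
    show ?thesis
      by (rule normalizable_forest[of _ 1 "nz (Y 0 1)" "nz (Y 0 1) * nz (Y 1 2)"
              "nz (Y 0 1) * nz (Y 1 2) * nz (Y 2 3)"
              "nz (Y 0 1) * nz (Y 1 2) * nz (Y 2 3) * nz (Y 3 4)"])
        (use assms 4 in simp_all)
  qed
qed

lemma normalizable_le_5:
  fixes Y :: "nat \<Rightarrow> nat \<Rightarrow> 'a::field"
  assumes n: "n \<le> 5" and vanish: "\<And>i j. n \<le> j \<Longrightarrow> Y i j = 0"
  shows "normalizable n Y"
proof -
  \<comment> \<open>A pivot in column 4 forces \<open>n = 5\<close>, which gives the bounds required
    by moves involving index 4.\<close>
  have n5: "n = 5" if "Y i 4 \<noteq> 0" for i
  proof (rule ccontr)
    assume "n \<noteq> 5"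
    then have "n \<le> 4" using n by simp
    then show False using vanish that by blast
  qed
  consider "Y 0 4 \<noteq> 0" | "Y 0 4 = 0" "Y 1 4 \<noteq> 0" | "Y 0 4 = 0" "Y 1 4 = 0" "Y 2 4 \<noteq> 0"
    | "Y 0 4 = 0" "Y 1 4 = 0" "Y 2 4 = 0" by blast
  then show ?thesis
  proof cases
    \<comment> \<open>Moves with \<open>b = 4\<close> clear the row of the pivot, those with
      \<open>a = 0\<close> its column. With the row cleared first, the latter change nothing else
      above the diagonal.\<close>
    case 1
    show ?thesis unfolding n5[OF 1]
      by (rule normalizable_move[of _ 1 4 "Y 0 1 / Y 0 4"],
          rule normalizable_move[of _ 2 4 "Y 0 2 / Y 0 4"],
          rule normalizable_move[of _ 3 4 "Y 0 3 / Y 0 4"],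
          rule normalizable_move[of _ 0 1 "- Y 1 4 / Y 0 4"],
          rule normalizable_move[of _ 0 2 "- Y 2 4 / Y 0 4"],
          rule normalizable_move[of _ 0 3 "- Y 3 4 / Y 0 4"],
          rule normalizable_pivot_04)
        (use 1 in \<open>simp_all add: move_def\<close>)
  next
    case 2
    show ?thesis unfolding n5[OF 2(2)]
      by (rule normalizable_move[of _ 1 2 "- Y 2 4 / Y 1 4"],
          rule normalizable_move[of _ 1 3 "- Y 3 4 / Y 1 4"],
          rule normalizable_move[of _ 2 4 "Y 1 2 / Y 1 4"],
          rule normalizable_move[of _ 3 4 "Y 1 3 / Y 1 4"],
          rule normalizable_pivot_14)
        (use 2 in \<open>simp_all add: move_def\<close>)
  next
    case 3
    show ?thesis unfolding n5[OF 3(3)]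
      by (rule normalizable_move[of _ 2 3 "- Y 3 4 / Y 2 4"],
          rule normalizable_move[of _ 3 4 "Y 2 3 / Y 2 4"],
          rule normalizable_pivot_24)
        (use 3 in \<open>simp_all add: move_def\<close>)
  next
    case 4
    then show ?thesis using n vanish by (intro normalizable_last_column_zero)
  qed
qed

section \<open>From normal forms to orbits\<close>

lemma coadjoint_orbit_eq_iff:
  "orbit (T_group TYPE('a::field) n) (coadjoint n) (dual_of n Y) =
    orbit (T_group TYPE('a) n) (coadjoint n) (dual_of n Z) \<longleftrightarrow> coadj_equiv n Y Z"
  (is "?O Y = ?O Z \<longleftrightarrow> _")
proof -
  interpret group_action "T_group TYPE('a) n" "ut_dual n" "coadjoint n"
    by (rule coadjoint_group_action)
  have mem: "dual_of n Z \<in> ?O Y \<longleftrightarrow> coadj_equiv n Y Z"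
    unfolding orbit_def coadj_equiv_def by (auto dest: sym)
  have "dual_of n Z \<in> ?O Z" by (rule orbit_refl[OF dual_of_in_ut_dual])
  moreover have "?O Y \<in> orbits (T_group TYPE('a) n) (ut_dual n) (coadjoint n)" for Y
    using dual_of_in_ut_dual by (auto simp: orbits_def)
  ultimately show ?thesis
    using disjoint_union[of "?O Y" "?O Z"] mem by blast
qed

lemma finite_orbits_le_5:
  assumes "n \<le> 5"
  shows "finite (orbits (T_group TYPE('a::field) n) (ut_dual n) (coadjoint n))"
proof -
  let ?O = "\<lambda>Y. orbit (T_group TYPE('a) n) (coadjoint n) (dual_of n Y)"
  define ofset where "ofset S = (\<lambda>i j. if (i, j) \<in> S then 1 else 0 :: 'a)" for S :: "(nat \<times> nat) set"
  have "orbits (T_group TYPE('a) n) (ut_dual n) (coadjoint n) \<subseteq> (\<lambda>S. ?O (ofset S)) ` Pow ({..<n} \<times> {..<n})"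
  proof
    fix X assume "X \<in> orbits (T_group TYPE('a) n) (ut_dual n) (coadjoint n)"
    then obtain f :: "'a mat \<Rightarrow> 'a" where f: "f \<in> ut_dual n" "X = orbit (T_group TYPE('a) n) (coadjoint n) f"
      by (auto simp: orbits_def)
    \<comment> \<open>Cutting off at column \<open>n\<close> supplies the zero padding without
      changing the functional.\<close>
    define Y where "Y i j = (if j < n then f (elem_mat n j i) else 0)" for i j
    have "dual_of n Y = f"
      using ut_dual_eq_dual_of[OF f(1)] dual_of_cong[of n Y "\<lambda>i j. f (elem_mat n j i)"]
      by (simp add: Y_def)
    have "normalizable n Y"
      using assms by (rule normalizable_le_5) (simp add: Y_def)
    then obtain Z where Z: "coadj_equiv n Y Z" "\<And>i j. i < j \<Longrightarrow> j < n \<Longrightarrow> Z i j \<in> {0, 1}"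
      unfolding normalizable_def by blast
    define S where "S = {(i, j). i < j \<and> j < n \<and> Z i j = 1}"
    have "dual_of n Z = dual_of n (ofset S)"
      using Z(2) by (intro dual_of_cong) (auto simp: S_def ofset_def)
    then have "X = ?O (ofset S)"
      using Z(1) f(2) \<open>dual_of n Y = f\<close> coadjoint_orbit_eq_iff[of n Y Z] by simp
    moreover have "S \<in> Pow ({..<n} \<times> {..<n})" by (auto simp: S_def)
    ultimately show "X \<in> (\<lambda>S. ?O (ofset S)) ` Pow ({..<n} \<times> {..<n})" by blast
  qed
  then show ?thesis by (rule finite_subset) simp
qed

section \<open>A one-parameter family for \<open>n > 5\<close>\<close>

text \<open>Positions \<open>(1, 3)\<close>, \<open>(1, 4)\<close>, \<open>(2, 3)\<close>,
  \<open>(2, 4)\<close> form a 4-cycle, on which the torus preserves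
  \<open>Y 1 3 * Y 2 4 / (Y 1 4 * Y 2 3) = c\<close>. The entries at \<open>(0, 2)\<close> and
  \<open>(3, 5)\<close> stop rows 1, 2 and columns 3, 4 from mixing.\<close>

definition dual_family :: "'a::field \<Rightarrow> nat \<Rightarrow> nat \<Rightarrow> 'a" where
  "dual_family c i j = (if (i, j) \<in> {(0, 2), (1, 3), (1, 4), (2, 3), (3, 5)} then 1
    else if (i, j) = (2, 4) then c else 0)"

lemma dual_family_inj:
  fixes c d :: "'a::field"
  assumes n: "n > 5" and cd: "coadj_equiv n (dual_family c) (dual_family d)"
  shows "c = d"
proof -
  obtain t where t: "t \<in> carrier (T_group TYPE('a) n)"
    and "coadjoint n t (dual_of n (dual_family c)) = dual_of n (dual_family d)"
    using cd by (auto simp: coadj_equiv_def)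
  then have e: "(\<Sum>k\<le>i. t $$ (i, k) * dual_family c k j) = (\<Sum>k=j..<n. dual_family d i k * t $$ (k, j))"
    if "i < j" "j < n" for i j
    using that coadjoint_dual_of_iff[OF t, of "dual_family c" "dual_family d"] by simp
  have "(\<Sum>k=j..<n. dual_family d i k * t $$ (k, j)) = (\<Sum>k=j..<6. dual_family d i k * t $$ (k, j))" for i j
    using n by (intro sum.mono_neutral_right) (auto simp: dual_family_def)
  then have e: "(\<Sum>k\<le>i. t $$ (i, k) * dual_family c k j) = (\<Sum>k=j..<6. dual_family d i k * t $$ (k, j))"
    if "i < j" "j < 6" for i j
    using e[of i j] that n by simp
  \<comment> \<open>Positions \<open>(0, 1)\<close> and \<open>(4, 5)\<close> give
    \<open>t $$ (2, 1) = 0\<close> and \<open>t $$ (4, 3) = 0\<close>; the four positions of the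
    cycle then equate the diagonal entries and yield \<open>c = d\<close>.\<close>
  note eqs = e[of 0 1] e[of 1 4] e[of 1 3] e[of 2 4] e[of 2 3] e[of 4 5]
  have "t $$ (2, 1) = 0" "t $$ (1, 1) = t $$ (4, 4)" "t $$ (1, 1) = t $$ (3, 3) + t $$ (4, 3)"
    "t $$ (2, 2) * c = d * t $$ (4, 4)" "t $$ (2, 2) = t $$ (3, 3) + d * t $$ (4, 3)" "t $$ (4, 3) = 0"
    using eqs by (simp_all add: dual_family_def eval_nat_numeral atLeastLessThanSuc)
  moreover have "t $$ (2, 2) \<noteq> 0" using T_group_diag[OF t] n by simp
  ultimately show ?thesis by simp
qed

lemma infinite_orbits_gt_5:
  assumes "n > 5"
  shows "infinite (orbits (T_group TYPE('a::field_char_0) n) (ut_dual n) (coadjoint n))"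
proof -
  let ?O = "\<lambda>c. orbit (T_group TYPE('a) n) (coadjoint n) (dual_of n (dual_family c))"
  have "inj ?O"
    using dual_family_inj[OF assms] by (auto intro!: injI simp: coadjoint_orbit_eq_iff)
  then have "infinite (range ?O)"
    using finite_imageD infinite_UNIV_char_0 by blast
  moreover have "range ?O \<subseteq> orbits (T_group TYPE('a) n) (ut_dual n) (coadjoint n)"
    using dual_of_in_ut_dual by (auto simp: orbits_def)
  ultimately show ?thesis by (rule infinite_super[rotated])
qed

theorem theorem1p15:
  fixes n :: nat
  shows "(n \<le> 5 \<longrightarrow>
      finite (orbits (T_group TYPE('k::field_char_0) n) (ut_dual n) (coadjoint n))) \<and>
    (n > 5 \<longrightarrow>
      infinite (orbits (T_group TYPE('k) n) (ut_dual n) (coadjoint n)))"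
  using finite_orbits_le_5 infinite_orbits_gt_5 by blast

end
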